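(* Let $\beta\ge1$ and consider the $\beta$-sampling game, with $\rho_j$ the average weight of the surviving elements in round $j$ and $\mathcal{E}_j$ the $\sigma$-algebra of the history through round $j$. For every adversary and all integers $0\le s<k$, $$\mathbf{E}[\rho_k\mid\mathcal{E}_s]\le\beta^2\rho_s .$$
   Context: The $\beta$-sampling game ($\beta\ge1$). Initially there is a finite set $\mathcal{S}_0$ of $m$ elements, each $A\in\mathcal{S}_0$ having a weight $w_0(A)\ge0$. In round $j$, $\mathcal{S}_j$ is the set of surviving elements and $w_j:\mathcal{S}_j\to\mathbb{R}_{\ge0}$ their weight function; $w_j(\mathcal{S}_j):=\sum_{A\in\mathcal{S}_j}w_j(A)$ and $\rho_j:=w_j(\mathcal{S}_j)/|\mathcal{S}_j|$. After observing the state through round $j$, the adversary chooses an $\mathcal{E}_j$-measurable deletion probability $d_{j+1}\in[0,1]$, and a fresh Bernoulli variable $D_{j+1}$ is drawn with $\Pr(D_{j+1}=1\mid\mathcal{E}_j)=d_{j+1}$. (1) If $D_{j+1}=0$, then $\mathcal{S}_{j+1}=\mathcal{S}_j$ and the adversary chooses a new weight function with $0\le w_{j+1}(A)\le w_j(A)$ for every $A\in\mathcal{S}_j$. (2) If $D_{j+1}=1$, the adversary chooses a probability distribution $\pi_j$ on $\mathcal{S}_j$ with $\beta^{-1}\frac{w_j(A)}{w_j(\mathcal{S}_j)}\le\pi_j(A)\le\beta\frac{w_j(A)}{w_j(\mathcal{S}_j)}$ for every $A\in\mathcal{S}_j$; an element $A^*\sim\pi_j$ is sampled and deleted, $\mathcal{S}_{j+1}=\mathcal{S}_j\setminus\{A^*\}$;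 finally the adversary chooses a new weight function with $0\le w_{j+1}(A)\le w_j(A)$ for every $A\in\mathcal{S}_{j+1}$. Here $\mathcal{E}_j$ is the $\sigma$-algebra generated by the complete history through round $j$, including the adversary's past decisions and randomness. The choices of $d_{j+1}$ and (when $D_{j+1}=1$) of $\pi_j$ are $\mathcal{E}_j$-measurable; any internal randomness used to make them is included in the history before $A^*$ is sampled. In particular $\mathcal{S}_j,w_j,\rho_j$ are $\mathcal{E}_j$-measurable. If $\mathcal{S}_j=\varnothing$ or $w_j(\mathcal{S}_j)=0$, the game stops and $\rho_\ell:=0$ for every $\ell\ge j$. *)

theory Defs
  imports "HOL-Probability.Probability"
begin

text \<open>
  A play of the game is a family of random variables on a probability space \<open>M\<close>:
  surviving sets \<open>S j\<close>, weights \<open>w j\<close>, deletion probabilities \<open>d (Suc j)\<close>, deletion indicators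
  \<open>D (Suc j)\<close>, sampling distributions \<open>p j\<close>, and sampled elements \<open>Astar (Suc j)\<close>.  The internal
  randomness available to the adversary at the end of round \<open>j\<close>, after \<open>Astar j\<close> has been drawn,
  is \<open>R j\<close>, with values in an arbitrary measurable space \<open>N j\<close>.  An adversary is thus any way of
  choosing \<open>w\<close>, \<open>d\<close>, \<open>p\<close> and \<open>R\<close> subject to the rules in the locale below.
\<close>

definition total_weight ::
  "(nat \<Rightarrow> 'a \<Rightarrow> 'e set) \<Rightarrow> (nat \<Rightarrow> 'a \<Rightarrow> 'e \<Rightarrow> real) \<Rightarrow> nat \<Rightarrow> 'a \<Rightarrow> real" where
  "total_weight S w j \<omega> = (\<Sum>A\<in>S j \<omega>. w j \<omega> A)"

text \<open>Once stopped, the game stays stopped: the values of the processes after the first stopping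
  round have no meaning and are not restricted by the rules.\<close>

definition stopped ::
  "(nat \<Rightarrow> 'a \<Rightarrow> 'e set) \<Rightarrow> (nat \<Rightarrow> 'a \<Rightarrow> 'e \<Rightarrow> real) \<Rightarrow> nat \<Rightarrow> 'a \<Rightarrow> bool" where
  "stopped S w j \<omega> \<longleftrightarrow> (\<exists>i\<le>j. S i \<omega> = {} \<or> total_weight S w i \<omega> = 0)"

definition avg_weight ::
  "(nat \<Rightarrow> 'a \<Rightarrow> 'e set) \<Rightarrow> (nat \<Rightarrow> 'a \<Rightarrow> 'e \<Rightarrow> real) \<Rightarrow> nat \<Rightarrow> 'a \<Rightarrow> real" where
  "avg_weight S w j \<omega> =
     (if stopped S w j \<omega> then 0 else total_weight S w j \<omega> / real (card (S j \<omega>)))"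

text \<open>The \<open>\<sigma>\<close>-algebra of the complete history through round \<open>j\<close>.\<close>

definition history ::
  "'a measure \<Rightarrow> (nat \<Rightarrow> 'r measure) \<Rightarrow> (nat \<Rightarrow> 'a \<Rightarrow> 'r) \<Rightarrow> 'e set
    \<Rightarrow> (nat \<Rightarrow> 'a \<Rightarrow> 'e set) \<Rightarrow> (nat \<Rightarrow> 'a \<Rightarrow> 'e \<Rightarrow> real)
    \<Rightarrow> (nat \<Rightarrow> 'a \<Rightarrow> real) \<Rightarrow> (nat \<Rightarrow> 'a \<Rightarrow> bool)
    \<Rightarrow> (nat \<Rightarrow> 'a \<Rightarrow> 'e pmf) \<Rightarrow> (nat \<Rightarrow> 'a \<Rightarrow> 'e) \<Rightarrow> nat \<Rightarrow> 'a measure" where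
  "history M N R S0 S w d D p Astar j = sigma (space M)
     ((\<Union>i\<in>{..j}.
          sets (vimage_algebra (space M) (R i) (N i))
        \<union> sets (vimage_algebra (space M) (S i) (count_space UNIV))
        \<union> (\<Union>A\<in>S0. sets (vimage_algebra (space M) (\<lambda>\<omega>. w i \<omega> A) borel)))
    \<union> (\<Union>i\<in>{..<j}.
          sets (vimage_algebra (space M) (d (Suc i)) borel)
        \<union> sets (vimage_algebra (space M) (D (Suc i)) (count_space UNIV))
        \<union> (\<Union>A\<in>S0. sets (vimage_algebra (space M) (\<lambda>\<omega>. pmf (p i \<omega>) A) borel))
        \<union> sets (vimage_algebra (space M) (Astar (Suc i)) (count_space UNIV))))"

text \<open>The history at the moment \<open>Astar (Suc j)\<close> is sampled: \<open>d (Suc j)\<close> and \<open>p j\<close> are already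
  measurable with respect to \<open>history \<dots> j\<close>, so only \<open>D (Suc j)\<close> is new.\<close>

definition presample_history ::
  "'a measure \<Rightarrow> (nat \<Rightarrow> 'r measure) \<Rightarrow> (nat \<Rightarrow> 'a \<Rightarrow> 'r) \<Rightarrow> 'e set
    \<Rightarrow> (nat \<Rightarrow> 'a \<Rightarrow> 'e set) \<Rightarrow> (nat \<Rightarrow> 'a \<Rightarrow> 'e \<Rightarrow> real)
    \<Rightarrow> (nat \<Rightarrow> 'a \<Rightarrow> real) \<Rightarrow> (nat \<Rightarrow> 'a \<Rightarrow> bool)
    \<Rightarrow> (nat \<Rightarrow> 'a \<Rightarrow> 'e pmf) \<Rightarrow> (nat \<Rightarrow> 'a \<Rightarrow> 'e) \<Rightarrow> nat \<Rightarrow> 'a measure" where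
  "presample_history M N R S0 S w d D p Astar j = sigma (space M)
     (sets (history M N R S0 S w d D p Astar j)
      \<union> sets (vimage_algebra (space M) (D (Suc j)) (count_space UNIV)))"

locale sampling_game = prob_space M
  for M :: "'a measure"
  and \<beta> :: real
  and S0 :: "'e set"
  and w0 :: "'e \<Rightarrow> real"
  and N :: "nat \<Rightarrow> 'r measure"
  and R :: "nat \<Rightarrow> 'a \<Rightarrow> 'r"
  and S :: "nat \<Rightarrow> 'a \<Rightarrow> 'e set"
  and w :: "nat \<Rightarrow> 'a \<Rightarrow> 'e \<Rightarrow> real"
  and d :: "nat \<Rightarrow> 'a \<Rightarrow> real"
  and D :: "nat \<Rightarrow> 'a \<Rightarrow> bool"
  and p :: "nat \<Rightarrow> 'a \<Rightarrow> 'e pmf"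
  and Astar :: "nat \<Rightarrow> 'a \<Rightarrow> 'e" +
  assumes meas_R: "\<And>j. R j \<in> measurable M (N j)"
    and meas_S: "\<And>j. S j \<in> measurable M (count_space UNIV)"
    and meas_w: "\<And>j A. A \<in> S0 \<Longrightarrow> (\<lambda>\<omega>. w j \<omega> A) \<in> borel_measurable M"
    and meas_D: "\<And>j. D (Suc j) \<in> measurable M (count_space UNIV)"
    and meas_Astar: "\<And>j. Astar (Suc j) \<in> measurable M (count_space UNIV)"
    and meas_d: "\<And>j. d (Suc j) \<in> borel_measurable (history M N R S0 S w d D p Astar j)"
    and meas_p: "\<And>j A. A \<in> S0 \<Longrightarrow>
          (\<lambda>\<omega>. pmf (p j \<omega>) A) \<in> borel_measurable (history M N R S0 S w d D p Astar j)"
    and finite_S0: "finite S0"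
    and w0_nonneg: "\<And>A. A \<in> S0 \<Longrightarrow> 0 \<le> w0 A"
    and init_S: "\<And>\<omega>. \<omega> \<in> space M \<Longrightarrow> S 0 \<omega> = S0"
    and init_w: "\<And>\<omega> A. \<omega> \<in> space M \<Longrightarrow> A \<in> S0 \<Longrightarrow> w 0 \<omega> A = w0 A"
    and d_range: "\<And>j \<omega>. \<omega> \<in> space M \<Longrightarrow> \<not> stopped S w j \<omega> \<Longrightarrow> d (Suc j) \<omega> \<in> {0..1}"
    and D_law: "\<And>j. AE \<omega> in M. \<not> stopped S w j \<omega> \<longrightarrow>
          real_cond_exp M (history M N R S0 S w d D p Astar j)
            (indicator {\<omega> \<in> space M. D (Suc j) \<omega>}) \<omega> = d (Suc j) \<omega>"
    and no_deletion: "\<And>j \<omega>. \<omega> \<in> space M \<Longrightarrow> \<not> stopped S w j \<omega> \<Longrightarrow> \<not> D (Suc j) \<omega> \<Longrightarrow>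
          S (Suc j) \<omega> = S j \<omega>"
    and p_support: "\<And>j \<omega>. \<omega> \<in> space M \<Longrightarrow> \<not> stopped S w j \<omega> \<Longrightarrow> D (Suc j) \<omega> \<Longrightarrow>
          set_pmf (p j \<omega>) \<subseteq> S j \<omega>"
    and p_lower: "\<And>j \<omega> A. \<omega> \<in> space M \<Longrightarrow> \<not> stopped S w j \<omega> \<Longrightarrow> D (Suc j) \<omega> \<Longrightarrow> A \<in> S j \<omega> \<Longrightarrow>
          inverse \<beta> * (w j \<omega> A / total_weight S w j \<omega>) \<le> pmf (p j \<omega>) A"
    and p_upper: "\<And>j \<omega> A. \<omega> \<in> space M \<Longrightarrow> \<not> stopped S w j \<omega> \<Longrightarrow> D (Suc j) \<omega> \<Longrightarrow> A \<in> S j \<omega> \<Longrightarrow>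
          pmf (p j \<omega>) A \<le> \<beta> * (w j \<omega> A / total_weight S w j \<omega>)"
    and Astar_mem: "\<And>j \<omega>. \<omega> \<in> space M \<Longrightarrow> \<not> stopped S w j \<omega> \<Longrightarrow> D (Suc j) \<omega> \<Longrightarrow>
          Astar (Suc j) \<omega> \<in> S j \<omega>"
    and Astar_law: "\<And>j A. A \<in> S0 \<Longrightarrow> AE \<omega> in M. \<not> stopped S w j \<omega> \<and> D (Suc j) \<omega> \<longrightarrow>
          real_cond_exp M (presample_history M N R S0 S w d D p Astar j)
            (indicator {\<omega> \<in> space M. Astar (Suc j) \<omega> = A}) \<omega> = pmf (p j \<omega>) A"
    and deletion: "\<And>j \<omega>. \<omega> \<in> space M \<Longrightarrow> \<not> stopped S w j \<omega> \<Longrightarrow> D (Suc j) \<omega> \<Longrightarrow>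
          S (Suc j) \<omega> = S j \<omega> - {Astar (Suc j) \<omega>}"
    and w_decreasing: "\<And>j \<omega> A. \<omega> \<in> space M \<Longrightarrow> \<not> stopped S w j \<omega> \<Longrightarrow> A \<in> S (Suc j) \<omega> \<Longrightarrow>
          0 \<le> w (Suc j) \<omega> A \<and> w (Suc j) \<omega> A \<le> w j \<omega> A"

end

theory Submission
  imports Defs
begin

text \<open>
  For a level \<open>x > 0\<close> call a surviving element heavy if its weight exceeds \<open>\<beta>\<^sup>2 * x\<close> and light if
  its weight is at most \<open>x\<close>.  With total weight \<open>W\<close>, each heavy element is sampled with
  probability at least \<open>q = \<beta> * x / W\<close> and each light one with probability at most \<open>q\<close>, so the
  fraction of heavy elements among the heavy and light ones is a supermartingale.
  The elements in between are ignored: counting them as light turns the fraction into the smaller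
  \<open>|{w > \<beta>\<^sup>2 * x}| / |S|\<close>, and counting them as heavy turns it into the larger \<open>|{w > x}| / |S|\<close>.  By the
  layer-cake formula these two integrate over \<open>x\<close> to \<open>\<rho> / \<beta>\<^sup>2\<close> and \<open>\<rho>\<close>.
\<close>

section \<open>Heavy and light elements of a fixed finite set, and the effect of one
  deletion\<close>

definition upper_frac :: "real \<Rightarrow> real \<Rightarrow> 'e set \<Rightarrow> ('e \<Rightarrow> real) \<Rightarrow> real" where
  "upper_frac c x T v =
     real (card {A\<in>T. c * x < v A}) /
       (real (card {A\<in>T. c * x < v A}) + real (card {A\<in>T. v A \<le> x}))"

text \<open>The exact change of \<open>upper_frac\<close> when \<open>A\<close> is deleted, except that division by zero makes it
  \<open>0\<close> instead of \<open>-1\<close> when \<open>A\<close> is the only counted element and is heavy.\<close>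

definition drift :: "real \<Rightarrow> real \<Rightarrow> 'e set \<Rightarrow> ('e \<Rightarrow> real) \<Rightarrow> 'e \<Rightarrow> real" where
  "drift c x T v A =
     (let h = real (card {A\<in>T. c * x < v A}); l = real (card {A\<in>T. v A \<le> x}) in
       (h * of_bool (v A \<le> x) - l * of_bool (c * x < v A)) / ((h + l) * (h + l - 1)))"

lemma upper_frac_nonneg: "0 \<le> upper_frac c x T v"
  by (simp add: upper_frac_def)

lemma upper_frac_le_1: "upper_frac c x T v \<le> 1"
  unfolding upper_frac_def by (rule divide_le_eq_1[THEN iffD2]) auto

lemma ratio_mono:
  fixes h h' l l' :: real
  assumes "0 \<le> h'" "h' \<le> h" "0 \<le> l" "l \<le> l'"
  shows "h' / (h' + l') \<le> h / (h + l)"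
\<comment> \<open>If \<open>h' = 0\<close>, the left side is \<open>0\<close> whatever its
  denominator, which covers \<open>0 / 0\<close>. Otherwise both denominators are positive and the
  claim amounts to \<open>h' * l \<le> h * l'\<close>.\<close>
proof (cases "h' = 0")
  case False
  then have "0 < h'" "0 < h" using assms by auto
  moreover have "h' * l \<le> h * l'" using assms by (intro mult_mono) auto
  ultimately show ?thesis using assms by (simp add: field_simps)
qed (use assms in auto)

text \<open>Lowering a weight can only take an element out of the heavy class or put it into the
  light class, so the adversary gains nothing from it at any level.\<close>

lemma upper_frac_mono:
  assumes "finite T" "\<And>A. A \<in> T \<Longrightarrow> v' A \<le> v A"
  shows "upper_frac c x T v' \<le> upper_frac c x T v"
  unfolding upper_frac_def
  by (rule ratio_mono) (auto intro!: card_mono simp: assms dest: assms(2))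

text \<open>Here \<open>h\<close> and \<open>l\<close> count what is left after the deletion of a
  light element in the first bound and of a heavy one in the second. Both bounds are equalities when
  \<open>h + l \<noteq> 0\<close>. Otherwise the second describes the loss of the only counted
  element: the left side is \<open>0 / 0 = 0\<close>, while the right side is \<open>1\<close>
  because its correction term divides by zero.\<close>

lemma ratio_delete:
  fixes h l :: real
  assumes "0 \<le> h" "0 \<le> l"
  shows "h / (h + l) \<le> h / (h + (l + 1)) + h / ((h + (l + 1)) * (h + l))"
    and "h / (h + l) \<le> (h + 1) / (h + 1 + l) - l / ((h + 1 + l) * (h + l))"
proof -
  have "h / (h + l) = h / (h + (l + 1)) + h / ((h + (l + 1)) * (h + l))
      \<and> h / (h + l) = (h + 1) / (h + 1 + l) - l / ((h + 1 + l) * (h + l))" if "h + l \<noteq> 0"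
  proof -
    define t where "t = h + l"
    have "t \<noteq> 0" "t + 1 \<noteq> 0" and [simp]: "h = t - l" using that assms by (auto simp: t_def)
    moreover have "h + (l + 1) = t + 1" "h + 1 + l = t + 1" by simp_all
    ultimately show ?thesis by (simp add: divide_simps) (simp add: algebra_simps)
  qed
  moreover have "h = 0" "l = 0" if "h + l = 0" using that assms by auto
  ultimately show "h / (h + l) \<le> h / (h + (l + 1)) + h / ((h + (l + 1)) * (h + l))"
    "h / (h + l) \<le> (h + 1) / (h + 1 + l) - l / ((h + 1 + l) * (h + l))"
    by (cases "h + l = 0"; force)+
qed

lemma upper_frac_delete:
  assumes "finite T" "A \<in> T" "1 \<le> c" "0 \<le> x"
  shows "upper_frac c x (T - {A}) v \<le> upper_frac c x T v + drift c x T v A"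
proof -
  let ?H = "{A\<in>T. c * x < v A}" and ?L = "{A\<in>T. v A \<le> x}"
  let ?H' = "{B\<in>T - {A}. c * x < v B}" and ?L' = "{B\<in>T - {A}. v B \<le> x}"
  have fin: "finite ?H" "finite ?L" using assms by auto
  \<comment> \<open>Heavy and light are disjoint classes, so deleting \<open>A\<close> lowers
    exactly one of the two counts or neither.\<close>
  have "x \<le> c * x" using assms mult_right_mono[of 1 c x] by simp
  then consider "v A \<le> x" "\<not> c * x < v A" | "c * x < v A" "\<not> v A \<le> x" | "\<not> v A \<le> x" "\<not> c * x < v A"
    by linarith
  then show ?thesis
  proof cases
    case 1
    then have e: "?H' = ?H" "?L' = ?L - {A}" by auto
    have "A \<in> ?L" using 1 assms by auto
    then have "card ?L = Suc (card ?L')" using fin unfolding e by (metis card_Suc_Diff1)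
    then have l: "real (card ?L) = real (card ?L') + 1" by simp
    show ?thesis unfolding upper_frac_def drift_def Let_def l e(1) using 1
      using ratio_delete(1)[of "real (card ?H)" "real (card ?L')"] by simp
  next
    case 2
    then have e: "?L' = ?L" "?H' = ?H - {A}" by auto
    have "A \<in> ?H" using 2 assms by auto
    then have "card ?H = Suc (card ?H')" using fin unfolding e by (metis card_Suc_Diff1)
    then have l: "real (card ?H) = real (card ?H') + 1" by simp
    show ?thesis unfolding upper_frac_def drift_def Let_def l e(1) using 2
      using ratio_delete(2)[of "real (card ?H')" "real (card ?L)"] by simp
  next
    case 3
    then have e: "?L' = ?L" "?H' = ?H" by auto
    show ?thesis unfolding upper_frac_def drift_def Let_def e using 3 by simp
  qed
qed

text \<open>Up to the common denominator, the sum is \<open>h\<close> times the mass of the light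
  elements minus \<open>l\<close> times the mass of the heavy ones. These masses are at most
  \<open>q * l\<close> and at least \<open>q * h\<close>, and the two products cancel.\<close>

lemma sum_drift_nonpos:
  assumes "finite T"
    and hi: "\<And>A. A \<in> T \<Longrightarrow> c * x < v A \<Longrightarrow> q \<le> \<pi> A"
    and lo: "\<And>A. A \<in> T \<Longrightarrow> v A \<le> x \<Longrightarrow> \<pi> A \<le> q"
  shows "(\<Sum>A\<in>T. \<pi> A * drift c x T v A) \<le> 0"
proof -
  define h l where "h = real (card {A\<in>T. c * x < v A})" and "l = real (card {A\<in>T. v A \<le> x})"
  have L: "(\<Sum>A\<in>T. \<pi> A * of_bool (v A \<le> x)) \<le> q * l"
  proof -
    have "(\<Sum>A\<in>T. \<pi> A * of_bool (v A \<le> x)) \<le> (\<Sum>A\<in>T. q * of_bool (v A \<le> x))"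
      by (rule sum_mono) (auto simp: lo)
    also have "\<dots> = q * l"
      using assms(1) by (simp add: l_def sum_distrib_left[symmetric] Int_def)
    finally show ?thesis .
  qed
  have H: "q * h \<le> (\<Sum>A\<in>T. \<pi> A * of_bool (c * x < v A))"
  proof -
    have "(\<Sum>A\<in>T. q * of_bool (c * x < v A)) \<le> (\<Sum>A\<in>T. \<pi> A * of_bool (c * x < v A))"
      by (rule sum_mono) (auto simp: hi)
    moreover have "(\<Sum>A\<in>T. q * of_bool (c * x < v A)) = q * h"
      using assms(1) by (simp add: h_def sum_distrib_left[symmetric] Int_def)
    ultimately show ?thesis by simp
  qed
  have "(\<Sum>A\<in>T. \<pi> A * drift c x T v A) =
      (h * (\<Sum>A\<in>T. \<pi> A * of_bool (v A \<le> x)) - l * (\<Sum>A\<in>T. \<pi> A * of_bool (c * x < v A)))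
        / ((h + l) * (h + l - 1))"
    unfolding drift_def Let_def h_def[symmetric] l_def[symmetric]
    by (simp add: sum_distrib_left sum_subtractf[symmetric] sum_divide_distrib algebra_simps)
  moreover have "h * (\<Sum>A\<in>T. \<pi> A * of_bool (v A \<le> x)) \<le> h * (q * l)"
    using L by (intro mult_left_mono) (auto simp: h_def)
  moreover have "l * (q * h) \<le> l * (\<Sum>A\<in>T. \<pi> A * of_bool (c * x < v A))"
    using H by (intro mult_left_mono) (auto simp: l_def)
  \<comment> \<open>The product is negative only strictly between \<open>0\<close> and
    \<open>1\<close>, where the integer count \<open>h + l\<close> cannot lie.\<close>
  moreover have "0 \<le> (h + l) * (h + l - 1)"
  proof -
    have "h + l = real (card {A\<in>T. c * x < v A} + card {A\<in>T. v A \<le> x})"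
      by (simp add: h_def l_def)
    then have "h + l = 0 \<or> 1 \<le> h + l"
      by (cases "card {A\<in>T. c * x < v A} + card {A\<in>T. v A \<le> x}") simp_all
    then show ?thesis by auto
  qed
  ultimately show ?thesis
    by (simp add: divide_nonpos_nonneg algebra_simps)
qed

section \<open>Layer-cake integration over the level\<close>

text \<open>With \<open>c = 1\<close> no element lies between the two classes, so the denominator is
  \<open>card T\<close> and the fraction is the proportion of elements of weight above
  \<open>x\<close>. Each \<open>A\<close> contributes on the levels \<open>{0..<v A}\<close>, an
  interval of length \<open>v A\<close>.\<close>

lemma nn_integral_upper_frac_1:
  assumes "finite T" "T \<noteq> {}" "\<And>A. A \<in> T \<Longrightarrow> 0 \<le> v A"
  shows "(\<integral>\<^sup>+x. ennreal (indicator {0..} x * upper_frac 1 x T v) \<partial>lborel)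
       = ennreal ((\<Sum>A\<in>T. v A) / real (card T))"
proof -
  have f: "indicator {0..} x * upper_frac 1 x T v
      = (\<Sum>A\<in>T. indicator {0..<v A} x) / real (card T)" for x :: real
  proof -
    have "T = {A\<in>T. x < v A} \<union> {A\<in>T. v A \<le> x}" by auto
    then have "card T = card {A\<in>T. x < v A} + card {A\<in>T. v A \<le> x}"
      using assms(1) by (subst card_Un_disjoint[symmetric]) auto
    moreover have "(\<Sum>A\<in>T. indicator {0..<v A} x :: real)
        = indicator {0..} x * (\<Sum>A\<in>T. of_bool (x < v A))"
      by (auto simp: sum_distrib_left indicator_def intro!: sum.cong)
    ultimately show ?thesis
      using assms(1) by (simp add: upper_frac_def Int_def)
  qed
  have n: "0 < real (card T)" using assms by (simp add: card_gt_0_iff)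
  have "(\<integral>\<^sup>+x. ennreal (indicator {0..} x * upper_frac 1 x T v) \<partial>lborel)
     = (\<integral>\<^sup>+x. (\<Sum>A\<in>T. indicator {0..<v A} x) * ennreal (1 / real (card T)) \<partial>lborel)"
  proof (rule nn_integral_cong)
    fix x :: real
    have "(\<Sum>A\<in>T. indicator {0..<v A} x :: ennreal) = ennreal (\<Sum>A\<in>T. indicator {0..<v A} x)"
      by (subst sum_ennreal[symmetric]) (auto simp: ennreal_indicator simp del: sum_ennreal)
    then show "ennreal (indicator {0..} x * upper_frac 1 x T v)
       = (\<Sum>A\<in>T. indicator {0..<v A} x) * ennreal (1 / real (card T))"
      unfolding f by (simp add: ennreal_mult[symmetric] sum_nonneg)
  qed
  also have "\<dots> = (\<Sum>A\<in>T. ennreal (v A)) * ennreal (1 / real (card T))"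
    by (subst nn_integral_multc) (auto simp: nn_integral_sum assms(3))
  also have "\<dots> = ennreal ((\<Sum>A\<in>T. v A) / real (card T))"
    using assms(3) by (simp add: sum_ennreal ennreal_mult[symmetric] sum_nonneg)
  finally show ?thesis .
qed

text \<open>Replacing \<open>c\<close> by \<open>1\<close> at the same level declares the elements
  in between heavy and leaves the light class alone.\<close>

lemma upper_frac_antimono:
  assumes "finite T" "1 \<le> c" "0 \<le> x"
  shows "upper_frac c x T v \<le> upper_frac 1 x T v"
proof -
  have "x \<le> c * x" using assms mult_right_mono[of 1 c x] by simp
  then show ?thesis unfolding upper_frac_def
    by (intro ratio_mono) (auto intro!: card_mono simp: assms)
qed

text \<open>Ratio \<open>1\<close> at level \<open>c * x\<close> keeps the heavy class and declares
  the elements in between light. Together with \<open>upper_frac_antimono\<close> this traps the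
  fraction between two plain proportions.\<close>

lemma upper_frac_scale:
  assumes "finite T" "1 \<le> c" "0 \<le> x"
  shows "upper_frac 1 (c * x) T v \<le> upper_frac c x T v"
proof -
  have "x \<le> c * x" using assms mult_right_mono[of 1 c x] by simp
  then show ?thesis unfolding upper_frac_def
    by (intro ratio_mono) (auto intro!: card_mono simp: assms)
qed

section \<open>Measurability and size of the fractions\<close>

lemma borel_measurable_card_Collect:
  assumes "finite I" "\<And>A. A \<in> I \<Longrightarrow> Measurable.pred M (P A)"
  shows "(\<lambda>\<omega>. real (card {A\<in>I. P A \<omega>})) \<in> borel_measurable M"
proof -
  have "(\<lambda>\<omega>. real (card {A\<in>I. P A \<omega>})) = (\<lambda>\<omega>. \<Sum>A\<in>I. of_bool (P A \<omega>))"
    using assms(1) by (simp add: Int_def)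
  then show ?thesis using assms(2) by simp
qed

text \<open>The set \<open>T \<omega>\<close> may be arbitrary, as the surviving set is after
  stopping; intersecting with the finite \<open>I\<close> turns both counts into finite sums of
  indicators. The level \<open>X\<close> is itself a function of the point, so that joint
  measurability in outcome and level is covered.\<close>

lemma borel_measurable_upper_frac:
  assumes "finite I" and [measurable]: "X \<in> borel_measurable M"
    and [measurable]: "\<And>A. A \<in> I \<Longrightarrow> Measurable.pred M (\<lambda>\<omega>. A \<in> T \<omega>)"
      "\<And>A. A \<in> I \<Longrightarrow> (\<lambda>\<omega>. v \<omega> A) \<in> borel_measurable M"
  shows "(\<lambda>\<omega>. upper_frac c (X \<omega>) (T \<omega> \<inter> I) (v \<omega>)) \<in> borel_measurable M"
proof -
  have "(\<lambda>\<omega>. real (card {A\<in>I. A \<in> T \<omega> \<and> c * X \<omega> < v \<omega> A})) \<in> borel_measurable M"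
    "(\<lambda>\<omega>. real (card {A\<in>I. A \<in> T \<omega> \<and> v \<omega> A \<le> X \<omega>})) \<in> borel_measurable M"
    by (rule borel_measurable_card_Collect[OF assms(1)]; measurable)+
  moreover have "{A\<in>T \<omega> \<inter> I. Q A} = {A\<in>I. A \<in> T \<omega> \<and> Q A}" for Q \<omega> by auto
  ultimately show ?thesis unfolding upper_frac_def by simp
qed

lemma borel_measurable_drift:
  assumes "finite I" "B \<in> I"
    and [measurable]: "\<And>A. A \<in> I \<Longrightarrow> Measurable.pred M (\<lambda>\<omega>. A \<in> T \<omega>)"
      "\<And>A. A \<in> I \<Longrightarrow> (\<lambda>\<omega>. v \<omega> A) \<in> borel_measurable M"
  shows "(\<lambda>\<omega>. drift c x (T \<omega> \<inter> I) (v \<omega>) B) \<in> borel_measurable M"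
proof -
  have [measurable]: "(\<lambda>\<omega>. real (card {A\<in>I. A \<in> T \<omega> \<and> c * x < v \<omega> A})) \<in> borel_measurable M"
    "(\<lambda>\<omega>. real (card {A\<in>I. A \<in> T \<omega> \<and> v \<omega> A \<le> x})) \<in> borel_measurable M"
    by (rule borel_measurable_card_Collect[OF assms(1)]; measurable)+
  have [measurable]: "(\<lambda>\<omega>. v \<omega> B) \<in> borel_measurable M" using assms by auto
  have "{A\<in>T \<omega> \<inter> I. Q A} = {A\<in>I. A \<in> T \<omega> \<and> Q A}" for Q \<omega> by auto
  then show ?thesis unfolding drift_def Let_def by simp
qed

text \<open>A crude bound, meant for integrability. The numerator is a difference of numbers between
  \<open>0\<close> and \<open>card T\<close>. The denominator is \<open>0\<close> if
  \<open>h + l \<le> 1\<close>, which makes the quotient \<open>0\<close>, and at least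
  \<open>1\<close> otherwise.\<close>

lemma abs_drift_le:
  assumes "finite T"
  shows "\<bar>drift c x T v A\<bar> \<le> real (card T)"
proof -
  define h l where "h = card {A\<in>T. c * x < v A}" and "l = card {A\<in>T. v A \<le> x}"
  have hl: "h \<le> card T" "l \<le> card T" unfolding h_def l_def by (auto intro!: card_mono simp: assms)
  have num: "\<bar>real h * of_bool (v A \<le> x) - real l * of_bool (c * x < v A)\<bar> \<le> real (card T)"
    using hl by (auto simp: of_bool_def)
  show ?thesis
  proof (cases "h + l \<le> 1")
    case True
    then consider "h = 0" "l = 0" | "h = 1" "l = 0" | "h = 0" "l = 1" by linarith
    then have "(real h + real l) * (real h + real l - 1) = 0" by cases auto
    then show ?thesis unfolding drift_def Let_def h_def[symmetric] l_def[symmetric] by (simp only: div_by_0)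
  next
    case False
    then have "2 \<le> real h + real l" by linarith
    then have "1 * 1 \<le> (real h + real l) * (real h + real l - 1)" by (intro mult_mono) auto
    then have "\<bar>n / ((real h + real l) * (real h + real l - 1))\<bar> \<le> \<bar>n\<bar>" for n :: real
      unfolding abs_divide by (subst divide_le_eq) (auto simp: mult_le_cancel_left1)
    from this[of "real h * of_bool (v A \<le> x) - real l * of_bool (c * x < v A)"]
    have "\<bar>drift c x T v A\<bar> \<le> \<bar>real h * of_bool (v A \<le> x) - real l * of_bool (c * x < v A)\<bar>"
      unfolding drift_def Let_def h_def[symmetric] l_def[symmetric] .
    with num show ?thesis by linarith
  qed
qed


section \<open>Generators of a sigma-algebra and bounds on conditional expectations\<close>

lemma measurable_if_vimage_sets_subset:
  assumes "space F = X" "f \<in> X \<rightarrow> space L" "sets (vimage_algebra X f L) \<subseteq> sets F"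
  shows "f \<in> measurable F L"
  using assms by (intro measurableI) (auto intro: in_vimage_algebra)

text \<open>The hypothesis is tested on the event \<open>E\<close> where the conditional expectation
  exceeds \<open>g\<close>. The excess has integral over \<open>E\<close> both nonnegative and
  nonpositive, so it vanishes almost everywhere; being positive on all of \<open>E\<close>, it
  forces \<open>E\<close> to be null.\<close>

lemma AE_real_cond_exp_le:
  assumes "sigma_finite_subalgebra M F"
    and f: "integrable M f" and g: "integrable M g" "g \<in> borel_measurable F"
    and le: "\<And>E. E \<in> sets F \<Longrightarrow> (\<integral>\<omega>. indicator E \<omega> * f \<omega> \<partial>M) \<le> (\<integral>\<omega>. indicator E \<omega> * g \<omega> \<partial>M)"
  shows "AE \<omega> in M. real_cond_exp M F f \<omega> \<le> g \<omega>"
proof -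
  interpret sigma_finite_subalgebra M F by fact
  note [measurable] = g(2)
  define E where "E = {\<omega> \<in> space F. g \<omega> < real_cond_exp M F f \<omega>}"
  have E: "E \<in> sets F" unfolding E_def by measurable
  then have EM: "E \<in> sets M" using subalg by (auto simp: subalgebra_def)
  have sp: "space F = space M" using subalg by (auto simp: subalgebra_def)
  have i: "integrable M (\<lambda>\<omega>. indicator E \<omega> * f \<omega>)" "integrable M (\<lambda>\<omega>. indicator E \<omega> * g \<omega>)"
    "integrable M (\<lambda>\<omega>. indicator E \<omega> * real_cond_exp M F f \<omega>)"
    using integrable_mult_indicator[OF EM f] integrable_mult_indicator[OF EM g(1)]
      integrable_mult_indicator[OF EM real_cond_exp_int(1)[OF f]] by simp_all
  let ?u = "\<lambda>\<omega>. indicator E \<omega> * real_cond_exp M F f \<omega> - indicator E \<omega> * g \<omega>"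
  have eq: "(\<integral>\<omega>. indicator E \<omega> * real_cond_exp M F f \<omega> \<partial>M) = (\<integral>\<omega>. indicator E \<omega> * f \<omega> \<partial>M)"
    using E f by (intro real_cond_exp_intg(2)[OF i(1)]) auto
  have nn: "AE \<omega> in M. 0 \<le> ?u \<omega>"
    by (auto simp: E_def split: split_indicator)
  have "(\<integral>\<omega>. ?u \<omega> \<partial>M) \<le> 0"
    using le[OF E] eq i by simp
  then have "(\<integral>\<omega>. ?u \<omega> \<partial>M) = 0"
    using integral_nonneg_AE[OF nn] by simp
  then have "AE \<omega> in M. ?u \<omega> = 0"
    using integral_nonneg_eq_0_iff_AE[OF _ nn] i by simp
  with AE_space show ?thesis
  proof eventually_elim
    case (elim \<omega>)
    then show ?case using sp by (cases "\<omega> \<in> E") (auto simp: E_def)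
  qed
qed

lemma stopped_mono: "stopped S w i \<omega> \<Longrightarrow> i \<le> j \<Longrightarrow> stopped S w j \<omega>"
  unfolding stopped_def by (meson order_trans)

section \<open>Sigma-algebras of the history\<close>

context sampling_game
begin

abbreviation hist where "hist j \<equiv> history M N R S0 S w d D p Astar j"

abbreviation prehist where "prehist j \<equiv> presample_history M N R S0 S w d D p Astar j"

lemma space_hist: "space (hist j) = space M"
  unfolding history_def by (rule space_measure_of_conv)

lemma space_prehist: "space (prehist j) = space M"
  unfolding presample_history_def by (rule space_measure_of_conv)

lemma vimage_sets_subset_Pow: "sets (vimage_algebra X f L) \<subseteq> Pow X"
  by (metis sets.space_closed space_vimage_algebra)

lemma sets_hist: "sets (hist j) = sigma_sets (space M)
     ((\<Union>i\<in>{..j}.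
          sets (vimage_algebra (space M) (R i) (N i))
        \<union> sets (vimage_algebra (space M) (S i) (count_space UNIV))
        \<union> (\<Union>A\<in>S0. sets (vimage_algebra (space M) (\<lambda>\<omega>. w i \<omega> A) borel)))
    \<union> (\<Union>i\<in>{..<j}.
          sets (vimage_algebra (space M) (d (Suc i)) borel)
        \<union> sets (vimage_algebra (space M) (D (Suc i)) (count_space UNIV))
        \<union> (\<Union>A\<in>S0. sets (vimage_algebra (space M) (\<lambda>\<omega>. pmf (p i \<omega>) A) borel))
        \<union> sets (vimage_algebra (space M) (Astar (Suc i)) (count_space UNIV))))"
  unfolding history_def
  by (rule sets_measure_of) (intro Un_least UN_least vimage_sets_subset_Pow)

lemma sets_prehist: "sets (prehist j) = sigma_sets (space M) (sets (hist j)
      \<union> sets (vimage_algebra (space M) (D (Suc j)) (count_space UNIV)))"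
  unfolding presample_history_def
  by (rule sets_measure_of)
    (intro Un_least vimage_sets_subset_Pow sets.space_closed[of "hist j", unfolded space_hist])

lemma sets_hist_mono: "i \<le> j \<Longrightarrow> sets (hist i) \<subseteq> sets (hist j)"
  unfolding sets_hist by (intro sigma_sets_mono') (auto intro!: Un_mono UN_mono)

text \<open>The rules state measurability of \<open>d (Suc i)\<close> and \<open>p i\<close> with
  respect to \<open>hist i\<close>, so their measurability with respect to \<open>M\<close> rests on
  the claim for the earlier rounds \<open>i < j\<close>; hence the strong induction.\<close>

lemma sets_hist_subset: "sets (hist j) \<subseteq> sets M"
proof (induction j rule: less_induct)
  case (less j)
  have d: "d (Suc i) \<in> borel_measurable M"
    and p: "A \<in> S0 \<Longrightarrow> (\<lambda>\<omega>. pmf (p i \<omega>) A) \<in> borel_measurable M" if "i < j" for i A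
    using meas_d[of i] meas_p[of A i] less[OF that]
    by (auto intro: measurable_from_subalg[of M "hist i"] simp: subalgebra_def space_hist)
  show ?case
    unfolding sets_hist
    by (intro sets.sigma_sets_subset Un_least UN_least sets_image_in_sets refl
        meas_R meas_S meas_w meas_D meas_Astar d p) auto
qed

lemma subalgebra_hist: "subalgebra M (hist j)"
  using sets_hist_subset by (simp add: subalgebra_def space_hist)

lemma subalgebra_prehist: "subalgebra M (prehist j)"
  unfolding subalgebra_def space_prehist sets_prehist
  by (intro conjI refl sets.sigma_sets_subset Un_least sets_hist_subset sets_image_in_sets meas_D)

lemma subalgebra_prehist_hist: "subalgebra (prehist j) (hist j)"
  unfolding subalgebra_def space_prehist space_hist sets_prehist by auto

lemma sigma_finite_subalgebraI: "subalgebra M F \<Longrightarrow> sigma_finite_subalgebra M F"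
  by (intro finite_measure_subalgebra_is_sigma_finite finite_measure_subalgebra.intro
      finite_measure_subalgebra_axioms.intro) (unfold_locales)

lemma hist_S: "i \<le> j \<Longrightarrow> S i \<in> measurable (hist j) (count_space UNIV)"
  by (rule measurable_if_vimage_sets_subset[OF space_hist])
    (auto simp: sets_hist intro!: sigma_sets.Basic)

lemma hist_w: "i \<le> j \<Longrightarrow> A \<in> S0 \<Longrightarrow> (\<lambda>\<omega>. w i \<omega> A) \<in> borel_measurable (hist j)"
  by (rule measurable_if_vimage_sets_subset[OF space_hist])
    (auto simp: sets_hist intro!: sigma_sets.Basic)

lemma prehist_D: "Measurable.pred (prehist j) (D (Suc j))"
  by (rule measurable_if_vimage_sets_subset[OF space_prehist])
    (auto simp: sets_prehist intro!: sigma_sets.Basic)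

lemma hist_mem_S: "i \<le> j \<Longrightarrow> Measurable.pred (hist j) (\<lambda>\<omega>. A \<in> S i \<omega>)"
  using measurable_compose[OF hist_S, of i j "\<lambda>T. A \<in> T" "count_space UNIV"] by simp

section \<open>The game before it stops\<close>

text \<open>The rules bind only before stopping, and a play running in round \<open>Suc j\<close>
  was running in round \<open>j\<close>, which carries the induction. The bound by \<open>w0\<close>
  later makes the average weight bounded.\<close>

lemma running:
  assumes "\<omega> \<in> space M" "\<not> stopped S w j \<omega>"
  shows "S j \<omega> \<subseteq> S0" "S j \<omega> \<noteq> {}" "total_weight S w j \<omega> \<noteq> 0"
    "A \<in> S j \<omega> \<Longrightarrow> 0 \<le> w j \<omega> A \<and> w j \<omega> A \<le> w0 A"
proof -
  show "S j \<omega> \<noteq> {}" "total_weight S w j \<omega> \<noteq> 0" using assms(2) by (auto simp: stopped_def)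
  have *: "S j \<omega> \<subseteq> S0 \<and> (\<forall>A\<in>S j \<omega>. 0 \<le> w j \<omega> A \<and> w j \<omega> A \<le> w0 A)"
    using assms(2)
  proof (induction j)
    case 0
    then show ?case using init_S init_w w0_nonneg assms(1) by auto
  next
    case (Suc j)
    then have ns: "\<not> stopped S w j \<omega>" using stopped_mono[of S w j \<omega> "Suc j"] by auto
    have "S (Suc j) \<omega> \<subseteq> S j \<omega>"
      using no_deletion[OF assms(1) ns] deletion[OF assms(1) ns] by (cases "D (Suc j) \<omega>") auto
    then show ?case using Suc.IH[OF ns] w_decreasing[OF assms(1) ns] by (meson order_trans subsetD)
  qed
  then show "S j \<omega> \<subseteq> S0" "A \<in> S j \<omega> \<Longrightarrow> 0 \<le> w j \<omega> A \<and> w j \<omega> A \<le> w0 A" by auto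
qed

lemma total_weight_pos:
  assumes "\<omega> \<in> space M" "\<not> stopped S w j \<omega>"
  shows "0 < total_weight S w j \<omega>"
  using running[OF assms] by (auto simp: total_weight_def less_le intro!: sum_nonneg)

text \<open>\<open>total_weight\<close> sums over a random set that is unrestricted after stopping.
  While the game runs, that set lies inside \<open>S0\<close>, so the inclusion can be added to the
  condition for running; the sum then becomes \<open>?W\<close>, over the fixed set
  \<open>S0\<close>. Since \<open>S l\<close> is measurable into a discrete space, membership in any
  family of sets is an event.\<close>

lemma hist_stopped:
  assumes "i \<le> j"
  shows "Measurable.pred (hist j) (stopped S w i)"
proof -
  let ?W = "\<lambda>i \<omega>. \<Sum>A\<in>S0. of_bool (A \<in> S i \<omega>) * w i \<omega> A"
  have "(\<not> stopped S w i \<omega>) = (\<forall>l\<in>{..i}. S l \<omega> \<in> {T. T \<subseteq> S0 \<and> T \<noteq> {}} \<and> ?W l \<omega> \<noteq> 0)"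
    if "\<omega> \<in> space M" for \<omega>
  proof -
    have W: "total_weight S w l \<omega> = ?W l \<omega>" if "S l \<omega> \<subseteq> S0" for l
      unfolding total_weight_def using that finite_S0
      by (intro sum.mono_neutral_cong_left) auto
    show ?thesis
    proof
      assume ns: "\<not> stopped S w i \<omega>"
      show "\<forall>l\<in>{..i}. S l \<omega> \<in> {T. T \<subseteq> S0 \<and> T \<noteq> {}} \<and> ?W l \<omega> \<noteq> 0"
      proof
        fix l assume "l \<in> {..i}"
        then have "\<not> stopped S w l \<omega>" using ns stopped_mono[of S w l \<omega> i] by auto
        from running[OF that this] show "S l \<omega> \<in> {T. T \<subseteq> S0 \<and> T \<noteq> {}} \<and> ?W l \<omega> \<noteq> 0"
          by (simp add: W)
      qed
    next
      assume "\<forall>l\<in>{..i}. S l \<omega> \<in> {T. T \<subseteq> S0 \<and> T \<noteq> {}} \<and> ?W l \<omega> \<noteq> 0"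
      then show "\<not> stopped S w i \<omega>" unfolding stopped_def by (auto simp: W)
    qed
  qed
  then have eq: "stopped S w i \<omega> = (\<not> (\<forall>l\<in>{..i}. S l \<omega> \<in> {T. T \<subseteq> S0 \<and> T \<noteq> {}} \<and> ?W l \<omega> \<noteq> 0))"
    if "\<omega> \<in> space (hist j)" for \<omega> using that space_hist by blast
  have S: "Measurable.pred (hist j) (\<lambda>\<omega>. S l \<omega> \<in> {T. T \<subseteq> S0 \<and> T \<noteq> {}})" if "l \<le> i" for l
    using measurable_compose[OF hist_S, of l j "\<lambda>T. T \<in> {T. T \<subseteq> S0 \<and> T \<noteq> {}}" "count_space UNIV"]
      that assms by simp
  have W: "?W l \<in> borel_measurable (hist j)" if "l \<le> i" for l
    using that assms hist_w hist_mem_S by (intro borel_measurable_sum borel_measurable_times) auto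
  have W': "Measurable.pred (hist j) (\<lambda>\<omega>. ?W l \<omega> \<noteq> 0)" if "l \<le> i" for l
    using W[OF that] by measurable
  show ?thesis
    by (subst measurable_cong[OF eq])
      (assumption, intro pred_intros_logic pred_intros_finite S W', auto)
qed

section \<open>The supermartingale at a fixed level\<close>

text \<open>The value \<open>0\<close> after stopping matches that of \<open>avg_weight\<close>. The
  intersection with \<open>S0\<close> changes nothing before stopping and keeps the set finite at
  every point.\<close>

definition alive_frac :: "nat \<Rightarrow> real \<Rightarrow> real \<Rightarrow> 'a \<Rightarrow> real" where
  "alive_frac j c x \<omega> =
     (if stopped S w j \<omega> then 0 else upper_frac c x (S j \<omega> \<inter> S0) (w j \<omega>))"

lemma alive_frac_bounds: "0 \<le> alive_frac j c x \<omega>" "alive_frac j c x \<omega> \<le> 1"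
  by (auto simp: alive_frac_def upper_frac_nonneg upper_frac_le_1)

text \<open>Joint measurability in outcome and level prepares the exchange of the two
  integrals.\<close>

lemma measurable_alive_frac: "(\<lambda>(\<omega>, x). alive_frac j c x \<omega>) \<in> borel_measurable (M \<Otimes>\<^sub>M borel)"
proof -
  note [measurable] = measurable_from_subalg[OF subalgebra_hist hist_stopped[OF order_refl]]
    measurable_from_subalg[OF subalgebra_hist hist_mem_S[OF order_refl]] meas_w
  have [measurable]: "(\<lambda>z. upper_frac c (snd z) (S j (fst z) \<inter> S0) (w j (fst z)))
      \<in> borel_measurable (M \<Otimes>\<^sub>M borel)"
    by (rule borel_measurable_upper_frac[OF finite_S0]; measurable)
  show ?thesis unfolding alive_frac_def case_prod_beta by measurable
qed

lemma integrable_alive_frac: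
  assumes [measurable]: "E \<in> sets M"
  shows "integrable M (\<lambda>\<omega>. indicator E \<omega> * alive_frac j c x \<omega>)"
proof (rule integrable_const_bound[where B = 1])
  have "(\<lambda>\<omega>. (\<lambda>(\<omega>, x). alive_frac j c x \<omega>) (\<omega>, x)) \<in> borel_measurable M"
    by (rule measurable_compose[OF _ measurable_alive_frac]) simp
  then have [measurable]: "alive_frac j c x \<in> borel_measurable M" by simp
  show "(\<lambda>\<omega>. indicator E \<omega> * alive_frac j c x \<omega>) \<in> borel_measurable M" by measurable
  show "AE \<omega> in M. norm (indicator E \<omega> * alive_frac j c x \<omega>) \<le> 1"
    using alive_frac_bounds[of j c x] by (auto split: split_indicator)
qed

text \<open>Pathwise, the fraction grows by at most the drift of the sampled element. Conditioning
  on the history before sampling replaces the indicator of each candidate by its probability, and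
  the averaged drift is nonpositive by \<open>sum_drift_nonpos\<close>.\<close>

lemma alive_frac_Suc_le:
  assumes "1 \<le> \<beta>" "0 \<le> x" "E \<in> sets (hist j)"
  shows "(\<integral>\<omega>. indicator E \<omega> * alive_frac (Suc j) (\<beta>\<^sup>2) x \<omega> \<partial>M)
       \<le> (\<integral>\<omega>. indicator E \<omega> * alive_frac j (\<beta>\<^sup>2) x \<omega> \<partial>M)"
proof -
  let ?c = "\<beta>\<^sup>2"
  have c: "1 \<le> ?c" using assms(1) by simp
  interpret P: sigma_finite_subalgebra M "prehist j"
    by (rule sigma_finite_subalgebraI[OF subalgebra_prehist])
  \<comment> \<open>\<open>\<kappa> A\<close> depends on the history through round \<open>j\<close>;
    \<open>f A\<close> adds the event of a deletion, which is known just before sampling. The factor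
    \<open>of_bool (A \<in> S j \<omega>)\<close> cuts the fixed index set \<open>S0\<close> down to
    the survivors.\<close>
  define \<kappa> where "\<kappa> A \<omega> =
    (if stopped S w j \<omega> then 0 else drift ?c x (S j \<omega> \<inter> S0) (w j \<omega>) A * of_bool (A \<in> S j \<omega>))" for A \<omega>
  define f where "f A \<omega> = indicator E \<omega> * of_bool (D (Suc j) \<omega>) * \<kappa> A \<omega>" for A \<omega>
  define I where "I A = (indicator {\<omega> \<in> space M. Astar (Suc j) \<omega> = A} :: 'a \<Rightarrow> real)" for A
  have \<kappa>: "\<kappa> A \<in> borel_measurable (hist j)" if "A \<in> S0" for A
  proof -
    note [measurable] = hist_stopped[OF order_refl] hist_mem_S[OF order_refl] hist_w[OF order_refl]
    have [measurable]: "(\<lambda>\<omega>. drift ?c x (S j \<omega> \<inter> S0) (w j \<omega>) A) \<in> borel_measurable (hist j)"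
      by (rule borel_measurable_drift[OF finite_S0 that]; measurable)
    show ?thesis unfolding \<kappa>_def by measurable
  qed
  have f: "f A \<in> borel_measurable (prehist j)" if "A \<in> S0" for A
  proof -
    have [measurable]: "\<kappa> A \<in> borel_measurable (prehist j)"
      using \<kappa>[OF that] subalgebra_prehist_hist by (rule measurable_from_subalg[rotated])
    have [measurable]: "E \<in> sets (prehist j)"
      using assms(3) subalgebra_prehist_hist by (auto simp: subalgebra_def)
    note [measurable] = prehist_D
    show ?thesis unfolding f_def by measurable
  qed
  have fM [measurable]: "f A \<in> borel_measurable M" if "A \<in> S0" for A
    by (rule measurable_from_subalg[OF subalgebra_prehist f[OF that]])
  have I [measurable]: "I A \<in> borel_measurable M" for A
  proof -
    have "{\<omega> \<in> space M. Astar (Suc j) \<omega> = A} = Astar (Suc j) -` {A} \<inter> space M" by auto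
    then show ?thesis unfolding I_def using measurable_sets[OF meas_Astar, of "{A}" j] by simp
  qed
  have "\<bar>drift ?c x (S j \<omega> \<inter> S0) (w j \<omega>) A\<bar> \<le> real (card S0)" for A \<omega>
    using abs_drift_le[of "S j \<omega> \<inter> S0" ?c x "w j \<omega>" A] card_mono[OF finite_S0, of "S j \<omega> \<inter> S0"] finite_S0
    by force
  then have "\<bar>f A \<omega> * I A \<omega>\<bar> \<le> real (card S0)" for A \<omega>
    by (auto simp: f_def \<kappa>_def I_def split: split_indicator)
  then have fI: "integrable M (\<lambda>\<omega>. f A \<omega> * I A \<omega>)" if "A \<in> S0" for A
    using that by (intro integrable_const_bound[where B = "real (card S0)"]) auto
  note cond = P.real_cond_exp_intg[OF fI f I]
  have af: "integrable M (\<lambda>\<omega>. indicator E \<omega> * alive_frac i ?c x \<omega>)" for i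
    using assms(3) sets_hist_subset by (intro integrable_alive_frac) blast
  have "(\<integral>\<omega>. indicator E \<omega> * alive_frac (Suc j) ?c x \<omega> \<partial>M)
      \<le> (\<integral>\<omega>. indicator E \<omega> * alive_frac j ?c x \<omega> + (\<Sum>A\<in>S0. f A \<omega> * I A \<omega>) \<partial>M)"
  proof (rule integral_mono)
    fix \<omega> assume \<omega>: "\<omega> \<in> space M"
    show "indicator E \<omega> * alive_frac (Suc j) ?c x \<omega>
      \<le> indicator E \<omega> * alive_frac j ?c x \<omega> + (\<Sum>A\<in>S0. f A \<omega> * I A \<omega>)"
    proof (cases "stopped S w j \<omega>")
      case True
      then have "stopped S w (Suc j) \<omega>" by (rule stopped_mono) simp
      with True show ?thesis by (simp add: alive_frac_def f_def \<kappa>_def)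
    next
      case ns: False
      note r = running[OF \<omega> ns]
      have fin: "finite (S j \<omega>)" using r(1) finite_S0 by (rule finite_subset)
      \<comment> \<open>The deletion is treated with the old weights, which are lowered afterwards.
        If the game stops in round \<open>Suc j\<close>, the left side is \<open>0\<close>.\<close>
      have F': "alive_frac (Suc j) ?c x \<omega> \<le> upper_frac ?c x (S (Suc j) \<omega>) (w j \<omega>)"
        if "S (Suc j) \<omega> \<subseteq> S j \<omega>"
      proof -
        have "S (Suc j) \<omega> \<inter> S0 = S (Suc j) \<omega>" using that r(1) by auto
        moreover have "finite (S (Suc j) \<omega>)" using that fin by (rule finite_subset)
        ultimately show ?thesis
          using w_decreasing[OF \<omega> ns]
          by (auto simp: alive_frac_def upper_frac_nonneg intro!: upper_frac_mono)
      qed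
      have F: "alive_frac j ?c x \<omega> = upper_frac ?c x (S j \<omega>) (w j \<omega>)"
        using ns r(1) by (simp add: alive_frac_def Int_absorb2)
      show ?thesis
      proof (cases "D (Suc j) \<omega>")
        case False
        then show ?thesis
          using F' F no_deletion[OF \<omega> ns] by (auto simp: f_def split: split_indicator)
      next
        case True
        let ?A = "Astar (Suc j) \<omega>"
        have A: "?A \<in> S j \<omega>" "?A \<in> S0" using Astar_mem[OF \<omega> ns True] r(1) by auto
        \<comment> \<open>The indicators \<open>I A\<close> select the element actually
          sampled.\<close>
        have "(\<Sum>A\<in>S0. f A \<omega> * I A \<omega>) = (\<Sum>A\<in>{?A}. f A \<omega> * I A \<omega>)"
          using A finite_S0 by (intro sum.mono_neutral_right) (auto simp: I_def)
        also have "\<dots> = f ?A \<omega> * I ?A \<omega>" by simp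
        also have "\<dots> = indicator E \<omega> * drift ?c x (S j \<omega>) (w j \<omega>) ?A"
        proof -
          have "I ?A \<omega> = 1" using \<omega> by (simp add: I_def)
          then show ?thesis using A ns True r(1) by (simp add: f_def \<kappa>_def Int_absorb2)
        qed
        finally have s: "(\<Sum>A\<in>S0. f A \<omega> * I A \<omega>) = indicator E \<omega> * drift ?c x (S j \<omega>) (w j \<omega>) ?A" .
        have "alive_frac (Suc j) ?c x \<omega> \<le> alive_frac j ?c x \<omega> + drift ?c x (S j \<omega>) (w j \<omega>) ?A"
          using F' upper_frac_delete[OF fin A(1) c assms(2), of "w j \<omega>"]
          unfolding F deletion[OF \<omega> ns True] by fastforce
        then show ?thesis unfolding s by (auto split: split_indicator)
      qed
    qed
  qed (intro af Bochner_Integration.integrable_add Bochner_Integration.integrable_sum fI; assumption)+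
  also have "\<dots> = (\<integral>\<omega>. indicator E \<omega> * alive_frac j ?c x \<omega> \<partial>M) + (\<Sum>A\<in>S0. \<integral>\<omega>. f A \<omega> * I A \<omega> \<partial>M)"
    using af fI by (subst Bochner_Integration.integral_add) auto
  \<comment> \<open>\<open>f A\<close> is measurable with respect to \<open>prehist j\<close>, so
    under the integral the indicator may be replaced by its conditional expectation.\<close>
  also have "(\<Sum>A\<in>S0. \<integral>\<omega>. f A \<omega> * I A \<omega> \<partial>M)
      = (\<Sum>A\<in>S0. \<integral>\<omega>. f A \<omega> * real_cond_exp M (prehist j) (I A) \<omega> \<partial>M)"
    using cond(2) by (intro sum.cong) auto
  also have "\<dots> = (\<integral>\<omega>. (\<Sum>A\<in>S0. f A \<omega> * real_cond_exp M (prehist j) (I A) \<omega>) \<partial>M)"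
    using cond(1) by (subst Bochner_Integration.integral_sum) auto
  also have "\<dots> \<le> 0"
  proof -
    \<comment> \<open>The sampling law has an exceptional null set for each \<open>A\<close>; as
      \<open>S0\<close> is finite, one null set serves all.\<close>
    have "AE \<omega> in M. \<forall>A\<in>S0. \<not> stopped S w j \<omega> \<and> D (Suc j) \<omega> \<longrightarrow>
        real_cond_exp M (prehist j) (I A) \<omega> = pmf (p j \<omega>) A"
      using finite_S0 Astar_law unfolding I_def by (intro AE_finite_allI) auto
    with AE_space have "AE \<omega> in M. (\<Sum>A\<in>S0. f A \<omega> * real_cond_exp M (prehist j) (I A) \<omega>) \<le> 0"
    proof eventually_elim
      case (elim \<omega>)
      note \<omega> = elim(1)
      show ?case
      proof (cases "\<not> stopped S w j \<omega> \<and> D (Suc j) \<omega>")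
        case True
        then have ns: "\<not> stopped S w j \<omega>" and D: "D (Suc j) \<omega>" by auto
        note r = running[OF \<omega> ns]
        let ?W = "total_weight S w j \<omega>"
        have W: "0 < ?W" by (rule total_weight_pos[OF \<omega> ns])
        have fin: "finite (S j \<omega>)" using r(1) finite_S0 by (rule finite_subset)
        have \<beta>: "0 < \<beta>" using assms(1) by simp
        have "(\<Sum>A\<in>S0. f A \<omega> * real_cond_exp M (prehist j) (I A) \<omega>)
            = (\<Sum>A\<in>S j \<omega>. f A \<omega> * pmf (p j \<omega>) A)"
          using elim(2) ns D r(1) finite_S0 by (intro sum.mono_neutral_cong_right) (auto simp: f_def \<kappa>_def)
        also have "\<dots> = indicator E \<omega> * (\<Sum>A\<in>S j \<omega>. pmf (p j \<omega>) A * drift ?c x (S j \<omega>) (w j \<omega>) A)"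
          using ns D r(1) by (auto simp: f_def \<kappa>_def Int_absorb2 sum_distrib_left mult_ac intro!: sum.cong)
        also have "(\<Sum>A\<in>S j \<omega>. pmf (p j \<omega>) A * drift ?c x (S j \<omega>) (w j \<omega>) A) \<le> 0"
        \<comment> \<open>The two sampling bounds meet at this \<open>q\<close>: a weight above
          \<open>\<beta>\<^sup>2 * x\<close> lifts the lower bound above it, and a weight of at most
          \<open>x\<close> keeps the upper bound from exceeding it. This explains the heavy
          threshold \<open>\<beta>\<^sup>2 * x\<close>.\<close>
        proof (rule sum_drift_nonpos[OF fin, where q = "\<beta> * (x / ?W)"])
          fix A assume A: "A \<in> S j \<omega>"
          show "\<beta> * (x / ?W) \<le> pmf (p j \<omega>) A" if "?c * x < w j \<omega> A"
          proof -
            have "\<beta> * (x / ?W) = inverse \<beta> * (?c * x / ?W)"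
              using \<beta> by (simp add: power2_eq_square)
            also have "\<dots> \<le> inverse \<beta> * (w j \<omega> A / ?W)"
              using \<beta> W that by (intro mult_left_mono divide_right_mono) auto
            also have "\<dots> \<le> pmf (p j \<omega>) A" by (rule p_lower[OF \<omega> ns D A])
            finally show ?thesis .
          qed
          show "pmf (p j \<omega>) A \<le> \<beta> * (x / ?W)" if "w j \<omega> A \<le> x"
          proof -
            have "pmf (p j \<omega>) A \<le> \<beta> * (w j \<omega> A / ?W)" by (rule p_upper[OF \<omega> ns D A])
            also have "\<dots> \<le> \<beta> * (x / ?W)"
              using \<beta> W that by (intro mult_left_mono divide_right_mono) auto
            finally show ?thesis .
          qed
        qed
        finally show ?thesis by (auto split: split_indicator)
      qed (auto simp: f_def \<kappa>_def)
    qed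
    then have "0 \<le> (\<integral>\<omega>. - (\<Sum>A\<in>S0. f A \<omega> * real_cond_exp M (prehist j) (I A) \<omega>) \<partial>M)"
      by (intro integral_nonneg_AE) auto
    then show ?thesis by simp
  qed
  finally show ?thesis by simp
qed

lemma alive_frac_le:
  assumes "1 \<le> \<beta>" "0 \<le> x" "E \<in> sets (hist s)" "s \<le> k"
  shows "(\<integral>\<omega>. indicator E \<omega> * alive_frac k (\<beta>\<^sup>2) x \<omega> \<partial>M)
       \<le> (\<integral>\<omega>. indicator E \<omega> * alive_frac s (\<beta>\<^sup>2) x \<omega> \<partial>M)"
  using assms(4)
proof (induction k rule: dec_induct)
  case (step k)
  have "E \<in> sets (hist k)" using assms(3) sets_hist_mono[OF step(1)] by blast
  from alive_frac_Suc_le[OF assms(1,2) this] step.IH show ?case by linarith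
qed simp

section \<open>The average weight as an integral over levels\<close>

lemma avg_weight_nonneg:
  assumes "\<omega> \<in> space M"
  shows "0 \<le> avg_weight S w j \<omega>"
  using total_weight_pos[OF assms] by (auto simp: avg_weight_def less_imp_le)

lemma borel_measurable_avg_weight: "avg_weight S w j \<in> borel_measurable (hist j)"
proof -
  note [measurable] = hist_stopped[OF order_refl] hist_mem_S[OF order_refl] hist_w[OF order_refl]
  let ?f = "\<lambda>\<omega>. if stopped S w j \<omega> then 0 else
    (\<Sum>A\<in>S0. of_bool (A \<in> S j \<omega>) * w j \<omega> A) / real (card {A\<in>S0. A \<in> S j \<omega>})"
  have "avg_weight S w j \<omega> = ?f \<omega>" if "\<omega> \<in> space (hist j)" for \<omega>
  proof (cases "stopped S w j \<omega>")
    case False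
    then have s: "S j \<omega> \<subseteq> S0" using that running(1) by (simp add: space_hist)
    then have "total_weight S w j \<omega> = (\<Sum>A\<in>S0. of_bool (A \<in> S j \<omega>) * w j \<omega> A)"
      unfolding total_weight_def using finite_S0 by (intro sum.mono_neutral_cong_left) auto
    moreover have "{A\<in>S0. A \<in> S j \<omega>} = S j \<omega>" using s by auto
    ultimately show ?thesis by (simp add: avg_weight_def False)
  qed (simp add: avg_weight_def)
  moreover have "?f \<in> borel_measurable (hist j)"
  proof -
    have [measurable]: "(\<lambda>\<omega>. real (card {A\<in>S0. A \<in> S j \<omega>})) \<in> borel_measurable (hist j)"
      by (rule borel_measurable_card_Collect[OF finite_S0]) measurable
    show ?thesis by measurable
  qed
  ultimately show ?thesis by (subst measurable_cong) auto
qed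

text \<open>While the game runs the surviving set is nonempty, so the average is at most the total
  weight, which never exceeds the initial one.\<close>

lemma integrable_avg_weight: "integrable M (avg_weight S w j)"
proof (rule integrable_const_bound[where B = "\<Sum>A\<in>S0. w0 A"])
  show "avg_weight S w j \<in> borel_measurable M"
    by (rule measurable_from_subalg[OF subalgebra_hist borel_measurable_avg_weight])
  have "avg_weight S w j \<omega> \<le> (\<Sum>A\<in>S0. w0 A)" if \<omega>: "\<omega> \<in> space M" for \<omega>
  proof (cases "stopped S w j \<omega>")
    case True
    then show ?thesis by (simp add: avg_weight_def sum_nonneg w0_nonneg)
  next
    case False
    note r = running[OF \<omega> False]
    have "1 \<le> card (S j \<omega>)"
      using r(1,2) finite_S0 by (metis One_nat_def Suc_leI card_gt_0_iff finite_subset)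
    then have "avg_weight S w j \<omega> \<le> total_weight S w j \<omega>"
      using total_weight_pos[OF \<omega> False]
      by (simp add: avg_weight_def False divide_le_eq mult_le_cancel_left1)
    also have "\<dots> \<le> (\<Sum>A\<in>S j \<omega>. w0 A)"
      unfolding total_weight_def using r(4) by (intro sum_mono) auto
    also have "\<dots> \<le> (\<Sum>A\<in>S0. w0 A)"
      using r(1) finite_S0 w0_nonneg by (intro sum_mono2) auto
    finally show ?thesis .
  qed
  then show "AE \<omega> in M. norm (avg_weight S w j \<omega>) \<le> (\<Sum>A\<in>S0. w0 A)"
    using avg_weight_nonneg by (intro AE_I2) auto
qed

lemma avg_weight_eq_nn_integral:
  assumes "\<omega> \<in> space M"
  shows "ennreal (avg_weight S w j \<omega>) = (\<integral>\<^sup>+x. ennreal (indicator {0..} x * alive_frac j 1 x \<omega>) \<partial>lborel)"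
proof (cases "stopped S w j \<omega>")
  case False
  note r = running[OF assms False]
  have "finite (S j \<omega>)" using r(1) finite_S0 by (rule finite_subset)
  from nn_integral_upper_frac_1[OF this r(2), of "w j \<omega>"] r(1,4) False show ?thesis
    by (simp add: alive_frac_def avg_weight_def total_weight_def Int_absorb2)
qed (simp add: alive_frac_def avg_weight_def)

lemma borel_measurable_alive_frac_snd:
  assumes "\<omega> \<in> space M"
  shows "(\<lambda>x. alive_frac j c x \<omega>) \<in> borel_measurable borel"
  using measurable_compose[OF _ measurable_alive_frac, of "\<lambda>x. (\<omega>, x)" borel] assms by simp

lemma nn_integral_alive_frac_le_avg_weight:
  assumes "\<omega> \<in> space M" "1 \<le> c"
  shows "(\<integral>\<^sup>+x. ennreal (indicator {0..} x * alive_frac j c x \<omega>) \<partial>lborel) \<le> ennreal (avg_weight S w j \<omega>)"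
  unfolding avg_weight_eq_nn_integral[OF assms(1)]
  using finite_S0 assms(2)
  by (intro nn_integral_mono ennreal_leI) (auto simp: alive_frac_def upper_frac_antimono split: split_indicator)

lemma avg_weight_le_nn_integral_alive_frac:
  assumes "\<omega> \<in> space M" "1 \<le> c"
  shows "ennreal (avg_weight S w j \<omega>)
    \<le> ennreal c * (\<integral>\<^sup>+x. ennreal (indicator {0..} x * alive_frac j c x \<omega>) \<partial>lborel)"
proof -
  note [measurable] = borel_measurable_alive_frac_snd[OF assms(1)]
  \<comment> \<open>Substituting \<open>c * x\<close> for the level produces the factor
    \<open>c\<close>, which becomes the \<open>\<beta>\<^sup>2\<close> of the theorem.\<close>
  have "ennreal (avg_weight S w j \<omega>)
      = ennreal c * (\<integral>\<^sup>+x. ennreal (indicator {0..} (c * x) * alive_frac j 1 (c * x) \<omega>) \<partial>lborel)"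
    unfolding avg_weight_eq_nn_integral[OF assms(1)]
    using assms(2) by (subst nn_integral_real_affine[where c = c and t = 0]) auto
  also have "\<dots> \<le> ennreal c * (\<integral>\<^sup>+x. ennreal (indicator {0..} x * alive_frac j c x \<omega>) \<partial>lborel)"
    using finite_S0 assms(2)
    by (intro mult_left_mono nn_integral_mono ennreal_leI)
      (auto simp: alive_frac_def upper_frac_scale zero_le_mult_iff split: split_indicator)
  finally show ?thesis .
qed

text \<open>The average weight in round \<open>k\<close> is at most \<open>\<beta>\<^sup>2\<close>
  times the integral of the fraction over the levels. Tonelli's theorem moves the integral over
  outcomes inside, the supermartingale inequality applies at each level, and after the exchange back
  the integral for round \<open>s\<close> is at most the average weight in round
  \<open>s\<close>.\<close>

lemma integral_avg_weight_le:
  assumes "1 \<le> \<beta>" "E \<in> sets (hist s)" "s \<le> k"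
  shows "(\<integral>\<omega>. indicator E \<omega> * avg_weight S w k \<omega> \<partial>M)
       \<le> (\<integral>\<omega>. indicator E \<omega> * (\<beta>\<^sup>2 * avg_weight S w s \<omega>) \<partial>M)"
proof -
  let ?c = "\<beta>\<^sup>2"
  have c: "1 \<le> ?c" using assms(1) by simp
  have E [measurable]: "E \<in> sets M" using assms(2) sets_hist_subset by blast
  interpret pair_sigma_finite M lborel by unfold_locales
  define G where "G j \<omega> x = ennreal (indicator E \<omega> * (indicator {0..} x * alive_frac j ?c x \<omega>))"
    for j \<omega> and x :: real
  note [measurable] = measurable_alive_frac borel_measurable_alive_frac_snd
  have "case_prod (G j) \<in> borel_measurable (M \<Otimes>\<^sub>M borel)" for j
    unfolding G_def by measurable
  then have G: "case_prod (G j) \<in> borel_measurable (M \<Otimes>\<^sub>M lborel)" for j by simp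
  have Gx: "(\<integral>\<^sup>+x. G j \<omega> x \<partial>lborel)
      = indicator E \<omega> * (\<integral>\<^sup>+x. ennreal (indicator {0..} x * alive_frac j ?c x \<omega>) \<partial>lborel)" for j \<omega>
    by (simp add: G_def split: split_indicator)
  have G\<omega>: "(\<integral>\<^sup>+\<omega>. G j \<omega> x \<partial>M)
      = ennreal (indicator {0..} x * (\<integral>\<omega>. indicator E \<omega> * alive_frac j ?c x \<omega> \<partial>M))" for j x
  proof (cases "0 \<le> x")
    case True
    then show ?thesis
      using nn_integral_eq_integral[OF integrable_alive_frac[OF E, of j ?c x]] alive_frac_bounds
      by (simp add: G_def)
  qed (simp add: G_def)
  have int: "integrable M (\<lambda>\<omega>. indicator E \<omega> * avg_weight S w j \<omega>)" for j
    using integrable_mult_indicator[OF E integrable_avg_weight] by simp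
  have nn: "AE \<omega> in M. 0 \<le> indicator E \<omega> * avg_weight S w j \<omega>" for j
    by (intro AE_I2 mult_nonneg_nonneg avg_weight_nonneg) auto
  have "ennreal (\<integral>\<omega>. indicator E \<omega> * avg_weight S w k \<omega> \<partial>M)
      = (\<integral>\<^sup>+\<omega>. indicator E \<omega> * ennreal (avg_weight S w k \<omega>) \<partial>M)"
    by (subst nn_integral_eq_integral[OF int nn, symmetric])
      (auto intro!: nn_integral_cong split: split_indicator)
  also have "\<dots> \<le> (\<integral>\<^sup>+\<omega>. ennreal ?c * (\<integral>\<^sup>+x. G k \<omega> x \<partial>lborel) \<partial>M)"
    unfolding Gx using avg_weight_le_nn_integral_alive_frac[OF _ c]
    by (intro nn_integral_mono) (auto split: split_indicator)
  also have "\<dots> = ennreal ?c * (\<integral>\<^sup>+x. (\<integral>\<^sup>+\<omega>. G k \<omega> x \<partial>M) \<partial>lborel)"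
    using G by (simp add: Fubini'[OF G] nn_integral_cmult lborel.borel_measurable_nn_integral)
  also have "\<dots> \<le> ennreal ?c * (\<integral>\<^sup>+x. (\<integral>\<^sup>+\<omega>. G s \<omega> x \<partial>M) \<partial>lborel)"
  proof (rule mult_left_mono[OF nn_integral_mono])
    fix x :: real
    show "(\<integral>\<^sup>+\<omega>. G k \<omega> x \<partial>M) \<le> (\<integral>\<^sup>+\<omega>. G s \<omega> x \<partial>M)"
      unfolding G\<omega> using alive_frac_le[OF assms(1) _ assms(2,3), of x]
      by (cases "0 \<le> x") (auto intro: ennreal_leI)
  qed simp
  also have "\<dots> = ennreal ?c * (\<integral>\<^sup>+\<omega>. (\<integral>\<^sup>+x. G s \<omega> x \<partial>lborel) \<partial>M)"
    by (simp add: Fubini'[OF G])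
  also have "\<dots> \<le> ennreal ?c * (\<integral>\<^sup>+\<omega>. ennreal (indicator E \<omega> * avg_weight S w s \<omega>) \<partial>M)"
    unfolding Gx using nn_integral_alive_frac_le_avg_weight[OF _ c]
    by (intro mult_left_mono nn_integral_mono) (auto split: split_indicator)
  also have "\<dots> = ennreal (?c * (\<integral>\<omega>. indicator E \<omega> * avg_weight S w s \<omega> \<partial>M))"
    using integral_nonneg_AE[OF nn] by (simp add: nn_integral_eq_integral[OF int nn] ennreal_mult)
  finally have "(\<integral>\<omega>. indicator E \<omega> * avg_weight S w k \<omega> \<partial>M)
      \<le> ?c * (\<integral>\<omega>. indicator E \<omega> * avg_weight S w s \<omega> \<partial>M)"
    using integral_nonneg_AE[OF nn] by (subst (asm) ennreal_le_iff) auto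
  then show ?thesis by (simp only: mult.left_commute[of _ ?c] integral_mult_right_zero)
qed

end

theorem theorem3p1:
  fixes M :: "'a measure" and \<beta> :: real
    and S0 :: "'e set" and w0 :: "'e \<Rightarrow> real"
    and N :: "nat \<Rightarrow> 'r measure" and R :: "nat \<Rightarrow> 'a \<Rightarrow> 'r"
    and S :: "nat \<Rightarrow> 'a \<Rightarrow> 'e set" and w :: "nat \<Rightarrow> 'a \<Rightarrow> 'e \<Rightarrow> real"
    and d :: "nat \<Rightarrow> 'a \<Rightarrow> real" and D :: "nat \<Rightarrow> 'a \<Rightarrow> bool"
    and p :: "nat \<Rightarrow> 'a \<Rightarrow> 'e pmf" and Astar :: "nat \<Rightarrow> 'a \<Rightarrow> 'e"
    and s k :: nat
  assumes "1 \<le> \<beta>"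
    and "sampling_game M \<beta> S0 w0 N R S w d D p Astar"
    and "s < k"
  shows "AE \<omega> in M.
      real_cond_exp M (history M N R S0 S w d D p Astar s) (avg_weight S w k) \<omega>
        \<le> \<beta>\<^sup>2 * avg_weight S w s \<omega>"
proof -
  interpret sampling_game M \<beta> S0 w0 N R S w d D p Astar by fact
  show ?thesis
  \<comment> \<open>Comparing integrals over all events of the history suffices, since the right
    side is measurable with respect to it.\<close>
  proof (rule AE_real_cond_exp_le)
    show "sigma_finite_subalgebra M (hist s)"
      by (rule sigma_finite_subalgebraI[OF subalgebra_hist])
    show "integrable M (avg_weight S w k)" "integrable M (\<lambda>\<omega>. \<beta>\<^sup>2 * avg_weight S w s \<omega>)"
      by (auto intro: integrable_avg_weight)
    show "(\<lambda>\<omega>. \<beta>\<^sup>2 * avg_weight S w s \<omega>) \<in> borel_measurable (hist s)"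
      using borel_measurable_avg_weight by measurable
    show "(\<integral>\<omega>. indicator E \<omega> * avg_weight S w k \<omega> \<partial>M)
       \<le> (\<integral>\<omega>. indicator E \<omega> * (\<beta>\<^sup>2 * avg_weight S w s \<omega>) \<partial>M)" if "E \<in> sets (hist s)" for E
      using assms(1,3) that by (intro integral_avg_weight_le) auto
  qed
qed

end
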